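(* Let $H$ be the expanded-clique graph of a pair $(G,f)$. Then $\gamma(H)+\alpha_2(G,f)=|V(G)|$.
   Context: All graphs are finite, simple and undirected. Let $G$ be a graph with vertex set $\{v_1,\dots,v_n\}$ and $f:V(G)\to\mathbb{N}$ a function with $f(v_i)\ge d_G(v_i)$ for every $i$. The expanded-clique graph $H$ of $(G,f)$ is the graph (unique up to isomorphism) defined as follows: $V(H)$ is the disjoint union of sets $V_1,\dots,V_n$, where $V_i$ has $f(v_i)$ vertices and forms a clique of $H$; for each edge $v_iv_j\in E(G)$ there are vertices $v_{i,j}\in V_i$ and $v_{j,i}\in V_j$ with $v_{i,j}v_{j,i}\in E(H)$, where the vertices $v_{i,j}$ (over all ordered pairs with $v_iv_j\in E(G)$) are pairwise distinct; and $H$ has no other edges. $\gamma(H)$ is the minimum size of a dominating set of $H$, i.e. of a set $D\subseteq V(H)$ such that every vertex of $V(H)\setminus D$ has a neighbor in $D$. A $2$-independent set of $G$ is a set of vertices of $G$ any two distinct members of which are at distance at least three in $G$. $\alpha_2(G,f)$ is the maximum cardinality of a $2$-independent set $S$ of $G$ such that every $v\in S$ satisfies $f(v)=d_G(v)$. *)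

theory Defs
  imports "Graph_Theory.Pair_Digraph" "Graph_Theory.Shortest_Path"
begin

text \<open>
  A finite simple undirected graph is a \<^locale>\<open>pair_graph\<close>: both orientations of every edge are
  present in \<^const>\<open>parcs\<close>, so the degree of a vertex is its \<^const>\<open>out_degree\<close>.
\<close>

abbreviation degree :: "'a pair_pre_digraph \<Rightarrow> 'a \<Rightarrow> nat" where
  "degree G v \<equiv> out_degree (with_proj G) v"

text \<open>
  The distance is the least length of a walk, and infinite between different components.
\<close>

definition graph_dist :: "'a pair_pre_digraph \<Rightarrow> 'a \<Rightarrow> 'a \<Rightarrow> ereal" where
  "graph_dist G u v = wf_digraph.\<mu> (with_proj G) (\<lambda>_. 1) u v"

definition two_independent :: "'a pair_pre_digraph \<Rightarrow> 'a set \<Rightarrow> bool" where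
  "two_independent G S \<longleftrightarrow>
     S \<subseteq> pverts G \<and> (\<forall>u\<in>S. \<forall>v\<in>S. u \<noteq> v \<longrightarrow> 3 \<le> graph_dist G u v)"

definition alpha2 :: "'a pair_pre_digraph \<Rightarrow> ('a \<Rightarrow> nat) \<Rightarrow> nat" where
  "alpha2 G f = Max {card S | S. two_independent G S \<and> (\<forall>v\<in>S. f v = degree G v)}"

definition dominating_set :: "'a pair_pre_digraph \<Rightarrow> 'a set \<Rightarrow> bool" where
  "dominating_set H D \<longleftrightarrow>
     D \<subseteq> pverts H \<and> (\<forall>v \<in> pverts H - D. \<exists>u\<in>D. (v, u) \<in> parcs H)"

definition domination_number :: "'a pair_pre_digraph \<Rightarrow> nat" where
  "domination_number H = Min {card D | D. dominating_set H D}"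

text \<open>
  Here \<open>W v\<close> is the clique replacing the vertex \<open>v\<close> of \<open>G\<close>, and \<open>c (u, v) \<in> W u\<close> is the end in
  \<open>W u\<close> of the edge of \<open>H\<close> arising from the edge \<open>uv\<close> of \<open>G\<close> (so \<open>c (v, u) \<in> W v\<close> is its other
  end). The expanded-clique graph is determined only up to isomorphism, hence a predicate on \<open>H\<close>.
\<close>

definition expanded_clique_graph ::
  "'a pair_pre_digraph \<Rightarrow> ('a \<Rightarrow> nat) \<Rightarrow> 'b pair_pre_digraph \<Rightarrow> bool" where
  "expanded_clique_graph G f H \<longleftrightarrow>
     (\<exists>(W :: 'a \<Rightarrow> 'b set) (c :: 'a \<times> 'a \<Rightarrow> 'b).
        (\<forall>v \<in> pverts G. finite (W v) \<and> card (W v) = f v) \<and>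
        (\<forall>u \<in> pverts G. \<forall>v \<in> pverts G. u \<noteq> v \<longrightarrow> W u \<inter> W v = {}) \<and>
        (\<forall>(u, v) \<in> parcs G. c (u, v) \<in> W u) \<and>
        inj_on c (parcs G) \<and>
        pverts H = (\<Union>v \<in> pverts G. W v) \<and>
        parcs H = {(x, y). x \<noteq> y \<and> (\<exists>v \<in> pverts G. x \<in> W v \<and> y \<in> W v)} \<union>
                  {(c (u, v), c (v, u)) | u v. (u, v) \<in> parcs G})"

lemma expanded_clique_graph_pair_graph:
  assumes "pair_graph G" and "expanded_clique_graph G f H"
  shows "pair_graph H"
proof -
  interpret G: pair_graph G by fact
  obtain W c where W: "\<forall>v \<in> pverts G. finite (W v) \<and> card (W v) = f v"
    and disj: "\<forall>u \<in> pverts G. \<forall>v \<in> pverts G. u \<noteq> v \<longrightarrow> W u \<inter> W v = {}"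
    and c: "\<forall>(u, v) \<in> parcs G. c (u, v) \<in> W u"
    and inj: "inj_on c (parcs G)"
    and vH: "pverts H = (\<Union>v \<in> pverts G. W v)"
    and eH: "parcs H = {(x, y). x \<noteq> y \<and> (\<exists>v \<in> pverts G. x \<in> W v \<and> y \<in> W v)} \<union>
                  {(c (u, v), c (v, u)) | u v. (u, v) \<in> parcs G}"
    using assms(2) unfolding expanded_clique_graph_def by (elim exE conjE) (rule that)
  have sub: "parcs H \<subseteq> pverts H \<times> pverts H"
  proof -
    have cv: "c (u, v) \<in> (\<Union>v \<in> pverts G. W v)" if "(u, v) \<in> parcs G" for u v
    proof (rule UN_I)
      show "u \<in> pverts G" using that by (rule G.in_arcsD1)
      show "c (u, v) \<in> W u" using c that by blast
    qed
    show ?thesis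
      unfolding eH vH by (blast intro: cv G.arcs_symmetric)
  qed
  have fin: "finite (pverts H)"
    unfolding vH using W G.finite_verts by simp
  have sym: "(y, x) \<in> parcs H" if "(x, y) \<in> parcs H" for x y
    using that G.arcs_symmetric unfolding eH by blast
  have loop: "x \<noteq> y" if "(x, y) \<in> parcs H" for x y
  proof
    assume "x = y"
    with that obtain u v where "(u, v) \<in> parcs G" "c (u, v) = c (v, u)"
      unfolding eH by auto
    with inj G.arcs_symmetric have "(u, v) = (v, u)"
      unfolding inj_on_def by blast
    with \<open>(u, v) \<in> parcs G\<close> show False using G.no_loops' by blast
  qed
  show ?thesis
  proof
    show "finite (parcs H)" using sub fin by (meson finite_SigmaI finite_subset)
    show "symmetric (with_proj H)" using sym unfolding symmetric_def by (simp add: sym_def)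
    show "finite (pverts H)" by (rule fin)
    show "fst e \<in> pverts H" if "e \<in> parcs H" for e
      using sub that by (metis SigmaD1 prod.collapse subsetD)
    show "snd e \<in> pverts H" if "e \<in> parcs H" for e
      using sub that by (metis SigmaD2 prod.collapse subsetD)
    show "fst e \<noteq> snd e" if "e \<in> parcs H" for e
      using loop[of "fst e" "snd e"] that by simp
  qed
qed

lemma expanded_clique_graph_exists:
  fixes G :: "'a pair_pre_digraph"
  assumes "pair_graph G" and f: "\<forall>v \<in> pverts G. degree G v \<le> f v"
  shows "\<exists>H :: ('a \<times> ('a + nat)) pair_pre_digraph. expanded_clique_graph G f H"
proof -
  interpret G: pair_graph G by fact
  define N where "N v = {w. (v, w) \<in> parcs G}" for v
  have N: "finite (N v)" "card (N v) = degree G v" for v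
  proof -
    have eq: "out_arcs (with_proj G) v = Pair v ` N v"
      by (auto simp: N_def out_arcs_def)
    show "card (N v) = degree G v"
      unfolding out_degree_def eq by (simp add: card_image inj_on_def)
    show "finite (N v)"
      using G.finite_out_arcs[of v] unfolding eq by (rule finite_imageD) (simp add: inj_on_def)
  qed
  define W where "W v = Pair v ` (Inl ` N v \<union> Inr ` {..<f v - degree G v})" for v
  define c :: "'a \<times> 'a \<Rightarrow> 'a \<times> ('a + nat)" where "c = (\<lambda>(u, v). (u, Inl v))"
  have "finite (W v)" for v
    using N by (simp add: W_def)
  moreover have "card (W v) = f v" if "v \<in> pverts G" for v
  proof -
    have "card (W v) = card (Inl ` N v \<union> Inr ` {..<f v - degree G v})"
      unfolding W_def by (rule card_image) (simp add: inj_on_def)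
    also have "\<dots> = card (N v) + (f v - degree G v)"
      by (subst card_Un_disjoint) (use N in \<open>auto simp: card_image inj_on_def\<close>)
    finally show ?thesis using N f that by simp
  qed
  moreover have "\<forall>u\<in>pverts G. \<forall>v\<in>pverts G. u \<noteq> v \<longrightarrow> W u \<inter> W v = {}"
    by (auto simp: W_def)
  moreover have "\<forall>(u, v)\<in>parcs G. c (u, v) \<in> W u"
    by (auto simp: W_def c_def N_def)
  moreover have "inj_on c (parcs G)"
    by (auto simp: c_def inj_on_def)
  ultimately have "expanded_clique_graph G f
    \<lparr> pverts = (\<Union>v \<in> pverts G. W v),
      parcs = {(x, y). x \<noteq> y \<and> (\<exists>v \<in> pverts G. x \<in> W v \<and> y \<in> W v)} \<union>
              {(c (u, v), c (v, u)) | u v. (u, v) \<in> parcs G} \<rparr>"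
    unfolding expanded_clique_graph_def by (intro exI[of _ W] exI[of _ c]) simp
  then show ?thesis by blast
qed

end

theory Submission
  imports Defs
begin

text \<open>
  A dominating set \<open>D\<close> misses a clique \<open>W v\<close> only if every vertex of \<open>W v\<close> is dominated from outside,
  which forces \<open>f v\<close> to be the degree of \<open>v\<close> and \<open>c (u, v) \<in> D\<close> for every neighbour \<open>u\<close> of \<open>v\<close>.
  Let every other vertex \<open>u\<close> nominate one missed neighbour. The missed vertices nominated by
  all their neighbours form a 2-independent set \<open>S\<close>, and the vertices outside \<open>S\<close> inject into \<open>D\<close>.
  Conversely, given a 2-independent set \<open>S\<close> with \<open>f = degree\<close> on it, one vertex from each clique
  outside \<open>S\<close> suffices to dominate, chosen as \<open>c (u, v)\<close> if \<open>u\<close> has a (necessarily unique)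
  neighbour \<open>v\<close> in \<open>S\<close>.
\<close>

section \<open>2-independence expressed through adjacency\<close>

context pair_graph
begin

lemma awalk_cost_one: "awalk_cost (\<lambda>_. 1) p = real (length p)"
  by (induction p) auto

lemma graph_dist_eq: "graph_dist G u v = (INF p \<in> {p. awalk u p v}. ereal (length p))"
  unfolding graph_dist_def \<mu>_def awalk_cost_one ..

text \<open>A lower bound on an infimum is a bound on every walk, and a walk with fewer than three
  arcs is empty, a single arc, or passes through a common neighbour. Symmetry of the arcs lets both
  arcs start at \<open>w\<close>.\<close>

lemma three_le_graph_dist_iff:
  assumes "u \<in> pverts G" "v \<in> pverts G"
  shows "3 \<le> graph_dist G u v \<longleftrightarrow>
    u \<noteq> v \<and> (u, v) \<notin> parcs G \<and> (\<forall>w. \<not> ((w, u) \<in> parcs G \<and> (w, v) \<in> parcs G))"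
proof -
  have "3 \<le> graph_dist G u v \<longleftrightarrow> (\<forall>p. awalk u p v \<longrightarrow> 3 \<le> length p)"
    by (simp add: graph_dist_eq le_INF_iff)
  also have "\<dots> \<longleftrightarrow>
    u \<noteq> v \<and> (u, v) \<notin> parcs G \<and> (\<forall>w. \<not> ((w, u) \<in> parcs G \<and> (w, v) \<in> parcs G))"
    (is "?long \<longleftrightarrow> ?far")
  proof
    assume long: ?long
    have no_walk: "\<not> awalk u p v" if "length p < 3" for p
      using long that by (meson not_le)
    have "u \<noteq> v"
      using no_walk[of "[]"] assms by (auto simp: awalk_simps)
    moreover have "(u, v) \<notin> parcs G"
      using no_walk[of "[(u, v)]"] assms by (auto simp: awalk_simps)
    moreover have "\<not> ((w, u) \<in> parcs G \<and> (w, v) \<in> parcs G)" for w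
      using no_walk[of "[(u, w), (w, v)]"] assms arcs_symmetric[of w u] by (auto simp: awalk_simps)
    ultimately show ?far
      by blast
  next
    assume far: ?far
    show ?long
    proof (intro allI impI, rule ccontr)
      fix p assume p: "awalk u p v" "\<not> 3 \<le> length p"
      \<comment> \<open>\<open>remdups_adj.cases\<close> is borrowed only for its split of a list
        into empty, singleton and at least two elements.\<close>
      then consider "p = []" | a where "p = [a]" | a b where "p = [a, b]"
        by (cases p rule: remdups_adj.cases) (auto simp: Suc_le_eq)
      then show False
      proof cases
        case 1
        then show ?thesis using p(1) far by (simp add: awalk_simps)
      next
        case 2
        then show ?thesis using p(1) far by (cases a) (simp add: awalk_simps)
      next
        case 3
        then show ?thesis
          using p(1) far arcs_symmetric[of u "snd a"]
          by (cases a; cases b) (simp add: awalk_simps)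
      qed
    qed
  qed
  finally show ?thesis .
qed

lemma two_independent_iff:
  "two_independent G S \<longleftrightarrow> S \<subseteq> pverts G \<and>
     (\<forall>u\<in>S. \<forall>v\<in>S. (u, v) \<notin> parcs G) \<and>
     (\<forall>u\<in>S. \<forall>v\<in>S. \<forall>w. (w, u) \<in> parcs G \<longrightarrow> (w, v) \<in> parcs G \<longrightarrow> u = v)"
proof (cases "S \<subseteq> pverts G")
  case True
  then have "two_independent G S \<longleftrightarrow> (\<forall>u\<in>S. \<forall>v\<in>S. u \<noteq> v \<longrightarrow>
    (u, v) \<notin> parcs G \<and> (\<forall>w. \<not> ((w, u) \<in> parcs G \<and> (w, v) \<in> parcs G)))"
    unfolding two_independent_def using three_le_graph_dist_iff by (meson subsetD)
  with True show ?thesis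
    using no_loops' by blast
qed (simp add: two_independent_def)

lemma degree_eq_card_neighbours: "degree G v = card {w. (v, w) \<in> parcs G}"
proof -
  have "out_arcs (with_proj G) v = Pair v ` {w. (v, w) \<in> parcs G}"
    by (auto simp: out_arcs_def)
  then show ?thesis
    unfolding out_degree_def by (simp add: card_image inj_on_def)
qed

section \<open>Sets attaining the maximum and the minimum\<close>

lemma alpha2_attained:
  obtains S where "two_independent G S" "\<forall>v\<in>S. f v = degree G v" "card S = alpha2 G f"
    and "\<And>T. two_independent G T \<Longrightarrow> \<forall>v\<in>T. f v = degree G v \<Longrightarrow> card T \<le> alpha2 G f"
proof -
  let ?C = "{card S | S. two_independent G S \<and> (\<forall>v\<in>S. f v = degree G v)}"
  have "?C \<subseteq> card ` Pow (pverts G)"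
    by (auto simp: two_independent_def)
  then have fin: "finite ?C"
    by (rule finite_subset) simp
  have "two_independent G {}"
    by (simp add: two_independent_def)
  then have "?C \<noteq> {}"
    by blast
  then have "alpha2 G f \<in> ?C"
    unfolding alpha2_def by (rule Max_in[OF fin])
  then obtain S where "two_independent G S" "\<forall>v\<in>S. f v = degree G v" "card S = alpha2 G f"
    by auto
  then show thesis
  proof (rule that)
    show "card T \<le> alpha2 G f" if "two_independent G T" "\<forall>v\<in>T. f v = degree G v" for T
      unfolding alpha2_def by (rule Max_ge[OF fin]) (use that in blast)
  qed
qed

end

lemma domination_number_attained:
  assumes "finite (pverts H)"
  obtains D where "dominating_set H D" "card D = domination_number H"
    and "\<And>D'. dominating_set H D' \<Longrightarrow> domination_number H \<le> card D'"
proof -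
  let ?C = "{card D | D. dominating_set H D}"
  have "?C \<subseteq> card ` Pow (pverts H)"
    by (auto simp: dominating_set_def)
  then have fin: "finite ?C"
    by (rule finite_subset) (simp add: assms)
  have "dominating_set H (pverts H)"
    by (simp add: dominating_set_def)
  then have "?C \<noteq> {}"
    by blast
  then have "domination_number H \<in> ?C"
    unfolding domination_number_def by (rule Min_in[OF fin])
  then obtain D where "dominating_set H D" "card D = domination_number H"
    by auto
  then show thesis
  proof (rule that)
    show "domination_number H \<le> card D'" if "dominating_set H D'" for D'
      unfolding domination_number_def by (rule Min_le[OF fin]) (use that in blast)
  qed
qed

text \<open>Fixes one choice of the witnesses behind the existential in
  \<open>expanded_clique_graph\<close>, so that all later constructions speak of the same cliques
  and cross edges.\<close>

locale clique_expansion = pair_graph G for G :: "'a pair_pre_digraph" +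
  fixes f :: "'a \<Rightarrow> nat" and H :: "'b pair_pre_digraph"
    and W :: "'a \<Rightarrow> 'b set" and c :: "'a \<times> 'a \<Rightarrow> 'b"
  assumes finite_W: "v \<in> pverts G \<Longrightarrow> finite (W v)"
    and card_W: "v \<in> pverts G \<Longrightarrow> card (W v) = f v"
    and W_disjoint: "u \<in> pverts G \<Longrightarrow> v \<in> pverts G \<Longrightarrow> u \<noteq> v \<Longrightarrow> W u \<inter> W v = {}"
    and c_in_W: "(u, v) \<in> parcs G \<Longrightarrow> c (u, v) \<in> W u"
    and inj_c: "inj_on c (parcs G)"
    and pverts_H: "pverts H = (\<Union>v \<in> pverts G. W v)"
    and parcs_H: "parcs H = {(x, y). x \<noteq> y \<and> (\<exists>v \<in> pverts G. x \<in> W v \<and> y \<in> W v)} \<union>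
                  {(c (u, v), c (v, u)) | u v. (u, v) \<in> parcs G}"
begin

lemma c_eqD: "c (u, v) = c (u', v') \<Longrightarrow> (u, v) \<in> parcs G \<Longrightarrow> (u', v') \<in> parcs G \<Longrightarrow> u = u' \<and> v = v'"
  using inj_c by (auto dest: inj_onD)

lemma W_unique: "x \<in> W u \<Longrightarrow> x \<in> W v \<Longrightarrow> u \<in> pverts G \<Longrightarrow> v \<in> pverts G \<Longrightarrow> u = v"
  using W_disjoint by blast

lemma finite_pverts_H: "finite (pverts H)"
  unfolding pverts_H using finite_W by simp

text \<open>By injectivity of \<open>c\<close>, the ends of cross edges in \<open>W v\<close> number
  exactly the degree of \<open>v\<close>; so equality of cardinalities means that every vertex of
  the clique is such an end.\<close>

lemma full_degree_iff:
  assumes "v \<in> pverts G"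
  shows "f v = degree G v \<longleftrightarrow> W v = (\<lambda>u. c (v, u)) ` {u. (v, u) \<in> parcs G}" (is "_ \<longleftrightarrow> W v = ?C")
proof -
  have "card ?C = degree G v"
    unfolding degree_eq_card_neighbours by (rule card_image) (auto simp: inj_on_def dest: c_eqD)
  moreover have "?C \<subseteq> W v"
    by (auto intro: c_in_W)
  ultimately show ?thesis
    using card_subset_eq[OF finite_W[OF assms], of ?C] card_W[OF assms] by auto
qed

section \<open>From a 2-independent set to a dominating set\<close>

lemma dominating_set_of_two_independent:
  assumes S: "two_independent G S" and full: "\<forall>v\<in>S. f v = degree G v"
  obtains D where "dominating_set H D" "card D + card S \<le> card (pverts G)"
proof -
  \<comment> \<open>A clique may be empty (\<open>f v = 0\<close>); it has no representative and
    needs none.\<close>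
  let ?K = "{v \<in> pverts G - S. W v \<noteq> {}}"
  have SV: "S \<subseteq> pverts G"
    and S_indep: "\<And>u v. u \<in> S \<Longrightarrow> v \<in> S \<Longrightarrow> (u, v) \<notin> parcs G"
    and S_unique: "\<And>u v w. u \<in> S \<Longrightarrow> v \<in> S \<Longrightarrow> (w, u) \<in> parcs G \<Longrightarrow> (w, v) \<in> parcs G \<Longrightarrow> u = v"
    using S unfolding two_independent_iff by blast+
  have "\<forall>v\<in>?K. \<exists>x. x \<in> W v \<and> (\<forall>u\<in>S. (v, u) \<in> parcs G \<longrightarrow> x = c (v, u))"
  proof
    fix v assume v: "v \<in> ?K"
    show "\<exists>x. x \<in> W v \<and> (\<forall>u\<in>S. (v, u) \<in> parcs G \<longrightarrow> x = c (v, u))"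
    proof (cases "\<exists>u\<in>S. (v, u) \<in> parcs G")
      case True
      \<comment> \<open>All neighbours of \<open>v\<close> in \<open>S\<close> coincide, so a single
        \<open>c (v, u)\<close> meets every requirement.\<close>
      then show ?thesis using c_in_W S_unique by metis
    next
      case False
      then show ?thesis using v by blast
    qed
  qed
  from bchoice[OF this] obtain r where r: "\<And>v. v \<in> ?K \<Longrightarrow> r v \<in> W v"
    and rc: "\<And>u v. v \<in> ?K \<Longrightarrow> u \<in> S \<Longrightarrow> (v, u) \<in> parcs G \<Longrightarrow> r v = c (v, u)"
    by blast
  have "dominating_set H (r ` ?K)"
    unfolding dominating_set_def
  proof (intro conjI ballI)
    show "r ` ?K \<subseteq> pverts H"
      using r unfolding pverts_H by blast
    fix x assume x: "x \<in> pverts H - r ` ?K"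
    then obtain v where v: "v \<in> pverts G" "x \<in> W v"
      unfolding pverts_H by blast
    show "\<exists>y\<in>r ` ?K. (x, y) \<in> parcs H"
    proof (cases "v \<in> S")
      case False
      then have K: "v \<in> ?K" using v by blast
      then have "x \<noteq> r v" using x by blast
      then have "(x, r v) \<in> parcs H"
        unfolding parcs_H using v r[OF K] by blast
      then show ?thesis using K by blast
    next
      case True
      \<comment> \<open>In a full clique, \<open>x\<close> is the end of a cross edge, whose other
        end \<open>c (u, v)\<close> was chosen as \<open>r u\<close>.\<close>
      then obtain u where u: "(v, u) \<in> parcs G" "x = c (v, u)"
        using full full_degree_iff v by blast
      then have uv: "(u, v) \<in> parcs G" by (blast intro: arcs_symmetric)
      \<comment> \<open>\<open>u\<close> is outside \<open>S\<close> because its neighbour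
        \<open>v\<close> is inside, and its clique contains \<open>c (u, v)\<close>.\<close>
      have K: "u \<in> ?K"
        using in_arcsD1[OF uv] c_in_W[OF uv] S_indep[OF True] u by blast
      have "(x, r u) \<in> parcs H"
        unfolding parcs_H rc[OF K True uv] using u by blast
      then show ?thesis using K by blast
    qed
  qed
  moreover have "card (r ` ?K) + card S \<le> card (pverts G)"
  proof -
    have "card (r ` ?K) \<le> card ?K"
      by (rule card_image_le) simp
    also have "\<dots> \<le> card (pverts G - S)"
      by (rule card_mono) auto
    finally show ?thesis
      using SV card_mono[OF finite_verts SV] finite_subset[OF SV finite_verts]
      by (simp add: card_Diff_subset)
  qed
  ultimately show thesis
    by (rule that)
qed

section \<open>From a dominating set to a 2-independent set\<close>

lemma missed_clique:
  assumes D: "dominating_set H D" and v: "v \<in> pverts G" "D \<inter> W v = {}"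
  shows "f v = degree G v" and "(u, v) \<in> parcs G \<Longrightarrow> c (u, v) \<in> D"
proof -
  \<comment> \<open>Since \<open>D\<close> avoids \<open>W v\<close>, the vertex dominating
    \<open>x\<close> lies in another clique and can reach \<open>x\<close> only along a cross edge.
    Hence every vertex of \<open>W v\<close> is an end of such an edge.\<close>
  have ex: "\<exists>u. (v, u) \<in> parcs G \<and> x = c (v, u) \<and> c (u, v) \<in> D" if x: "x \<in> W v" for x
  proof -
    obtain y where y: "y \<in> D" "(x, y) \<in> parcs H"
      using D v x unfolding dominating_set_def pverts_H by blast
    moreover have "\<not> (\<exists>w \<in> pverts G. x \<in> W w \<and> y \<in> W w)"
      using W_unique x v y by blast
    ultimately obtain a b where ab: "(a, b) \<in> parcs G" "x = c (a, b)" "y = c (b, a)"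
      unfolding parcs_H by blast
    moreover have "a = v"
      using W_unique x v ab c_in_W in_arcsD1 by blast
    ultimately show ?thesis using y by blast
  qed
  then show "f v = degree G v"
    unfolding full_degree_iff[OF v(1)] using c_in_W by blast
  show "c (u, v) \<in> D" if uv: "(u, v) \<in> parcs G"
  proof -
    have vu: "(v, u) \<in> parcs G" using uv by (rule arcs_symmetric)
    \<comment> \<open>Apply \<open>ex\<close> to \<open>c (v, u)\<close>; injectivity of
      \<open>c\<close> then forces \<open>w = u\<close>.\<close>
    then obtain w where "(v, w) \<in> parcs G" "c (v, u) = c (v, w)" "c (w, v) \<in> D"
      using ex c_in_W by blast
    then show ?thesis using c_eqD vu by blast
  qed
qed

lemma two_independent_of_dominating_set:
  assumes D: "dominating_set H D"
  obtains S where "two_independent G S" "\<forall>v\<in>S. f v = degree G v"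
    "card (pverts G) \<le> card D + card S"
proof -
  define M where "M = {v \<in> pverts G. D \<inter> W v = {}}"
  have M: "v \<in> pverts G" "f v = degree G v" "(u, v) \<in> parcs G \<Longrightarrow> c (u, v) \<in> D"
    if "v \<in> M" for u v
    using that missed_clique[OF D] unfolding M_def by blast+
  \<comment> \<open>Otherwise \<open>c (u, v)\<close> would lie in both \<open>D\<close> and the
    missed clique \<open>W u\<close>.\<close>
  have M_indep: "(u, v) \<notin> parcs G" if "u \<in> M" "v \<in> M" for u v
    using that M(3) c_in_W unfolding M_def by blast
  \<comment> \<open>The nomination; its value is arbitrary if \<open>u\<close> has no neighbour in
    \<open>M\<close>.\<close>
  define p where "p u = (SOME v. v \<in> M \<and> (u, v) \<in> parcs G)" for u
  have p: "p u \<in> M \<and> (u, p u) \<in> parcs G" if "v \<in> M" "(u, v) \<in> parcs G" for u v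
    unfolding p_def by (rule someI[of _ v]) (use that in blast)
  \<comment> \<open>The representative in \<open>D\<close> of a clique that is not missed is tied to
    the nomination, so that the ends of its cross edges to other missed neighbours stay
    free.\<close>
  have "\<forall>u\<in>pverts G - M. \<exists>x. x \<in> D \<inter> W u \<and> (\<forall>v\<in>M. (u, v) \<in> parcs G \<longrightarrow> x = c (u, p u))"
  proof
    fix u assume u: "u \<in> pverts G - M"
    show "\<exists>x. x \<in> D \<inter> W u \<and> (\<forall>v\<in>M. (u, v) \<in> parcs G \<longrightarrow> x = c (u, p u))"
    proof (cases "\<exists>v\<in>M. (u, v) \<in> parcs G")
      case True
      then show ?thesis using p M(3) c_in_W by blast
    next
      case False
      then show ?thesis using u unfolding M_def by blast
    qed
  qed
  from bchoice[OF this] obtain r where r: "\<And>u. u \<in> pverts G - M \<Longrightarrow> r u \<in> D \<inter> W u"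
    and rc: "\<And>u v. u \<in> pverts G - M \<Longrightarrow> v \<in> M \<Longrightarrow> (u, v) \<in> parcs G \<Longrightarrow> r u = c (u, p u)"
    by blast
  \<comment> \<open>Two members of \<open>S\<close> with a common neighbour \<open>w\<close> both
    equal \<open>p w\<close>, which yields 2-independence.\<close>
  define S where "S = {v \<in> M. \<forall>u. (u, v) \<in> parcs G \<longrightarrow> p u = v}"
  have SV: "S \<subseteq> pverts G"
    using M(1) unfolding S_def by blast
  have "\<forall>v\<in>M - S. \<exists>u. (u, v) \<in> parcs G \<and> p u \<noteq> v"
    unfolding S_def by blast
  from bchoice[OF this] obtain q where q: "\<And>v. v \<in> M - S \<Longrightarrow> (q v, v) \<in> parcs G \<and> p (q v) \<noteq> v"
    by blast
  \<comment> \<open>A missed clique contains nothing of \<open>D\<close>, so \<open>v\<close> in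
    \<open>M - S\<close> takes an element of \<open>D\<close> from the clique of a neighbour
    \<open>q v\<close> that nominates another vertex.\<close>
  define g where "g v = (if v \<in> M then c (q v, v) else r v)" for v
  \<comment> \<open>A collision places both elements in one clique, so \<open>w = q v\<close>; but
    then \<open>r w\<close> is the end towards \<open>p w\<close>, which differs from
    \<open>v\<close>.\<close>
  have clash: "c (q v, v) \<noteq> r w" if v: "v \<in> M - S" and w: "w \<in> pverts G - M" for v w
  proof
    assume eq: "c (q v, v) = r w"
    have qv: "(q v, v) \<in> parcs G" using q v by blast
    then have "c (q v, v) \<in> W (q v)" "q v \<in> pverts G"
      by (rule c_in_W, rule in_arcsD1)
    then have "q v = w"
      using W_unique eq r[OF w] w by auto
    then have "c (q v, v) = c (q v, p (q v))" "(q v, p (q v)) \<in> parcs G"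
      using rc[OF w] p v qv eq by auto
    then show False using c_eqD[OF _ qv] q[OF v] by metis
  qed
  have "inj_on g (pverts G - S)"
  proof (rule inj_onI)
    fix v w assume v: "v \<in> pverts G - S" and w: "w \<in> pverts G - S" and eq: "g v = g w"
    consider "v \<in> M" "w \<in> M" | "v \<notin> M" "w \<notin> M" | "v \<in> M" "w \<notin> M" | "v \<notin> M" "w \<in> M"
      by blast
    then show "v = w"
    proof cases
      case 1
      then show ?thesis using eq q[of v] q[of w] v w c_eqD[of "q v" v "q w" w] unfolding g_def by simp
    next
      case 2
      then show ?thesis using eq r[of v] r[of w] v w W_unique unfolding g_def by auto
    next
      case 3
      then show ?thesis using eq clash[of v w] v w unfolding g_def by auto
    next
      case 4
      then show ?thesis using eq clash[of w v] v w unfolding g_def by auto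
    qed
  qed
  moreover have "g ` (pverts G - S) \<subseteq> D"
    using r q M(3) unfolding g_def by auto
  moreover have "finite D"
    using D finite_pverts_H finite_subset unfolding dominating_set_def by blast
  ultimately have "card (pverts G - S) \<le> card D"
    by (rule card_inj_on_le)
  then have "card (pverts G) \<le> card D + card S"
    using SV finite_subset[OF SV finite_verts] by (simp add: card_Diff_subset)
  moreover have "two_independent G S"
    unfolding two_independent_iff
    using SV M_indep unfolding S_def by blast
  moreover have "\<forall>v\<in>S. f v = degree G v"
    using M(2) unfolding S_def by blast
  ultimately show thesis
    using that by blast
qed

text \<open>Each extremal set is converted into a set of the other kind, whose size is then compared
  with the other extremum.\<close>

lemma domination_number_add_alpha2: "domination_number H + alpha2 G f = card (pverts G)"
proof (rule antisym)
  obtain S where S: "two_independent G S" "\<forall>v\<in>S. f v = degree G v" "card S = alpha2 G f"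
    and S_max: "\<And>T. two_independent G T \<Longrightarrow> \<forall>v\<in>T. f v = degree G v \<Longrightarrow> card T \<le> alpha2 G f"
    using alpha2_attained by blast
  obtain D where D: "dominating_set H D" "card D = domination_number H"
    and D_min: "\<And>D'. dominating_set H D' \<Longrightarrow> domination_number H \<le> card D'"
    using domination_number_attained[OF finite_pverts_H] by blast
  obtain D' where D': "dominating_set H D'" "card D' + card S \<le> card (pverts G)"
    using dominating_set_of_two_independent[OF S(1,2)] by blast
  then show "domination_number H + alpha2 G f \<le> card (pverts G)"
    using D_min[OF D'(1)] S(3) by linarith
  obtain S' where S': "two_independent G S'" "\<forall>v\<in>S'. f v = degree G v"
    "card (pverts G) \<le> card D + card S'"
    using two_independent_of_dominating_set[OF D(1)] by blast
  then show "card (pverts G) \<le> domination_number H + alpha2 G f"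
    using S_max[OF S'(1,2)] D(2) by linarith
qed

end

theorem theorem3p5:
  fixes G :: "'a pair_pre_digraph" and H :: "'b pair_pre_digraph" and f :: "'a \<Rightarrow> nat"
  assumes "pair_graph G"
    and "\<forall>v \<in> pverts G. degree G v \<le> f v"
    and "expanded_clique_graph G f H"
  shows "domination_number H + alpha2 G f = card (pverts G)"
proof -
  interpret pair_graph G by fact
  obtain W c where "\<forall>v \<in> pverts G. finite (W v) \<and> card (W v) = f v"
    "\<forall>u \<in> pverts G. \<forall>v \<in> pverts G. u \<noteq> v \<longrightarrow> W u \<inter> W v = {}"
    "\<forall>(u, v) \<in> parcs G. c (u, v) \<in> W u"
    "inj_on c (parcs G)"
    "pverts H = (\<Union>v \<in> pverts G. W v)"
    "parcs H = {(x, y). x \<noteq> y \<and> (\<exists>v \<in> pverts G. x \<in> W v \<and> y \<in> W v)} \<union>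
       {(c (u, v), c (v, u)) | u v. (u, v) \<in> parcs G}"
    using assms(3) unfolding expanded_clique_graph_def by (elim exE conjE) (rule that)
  then interpret clique_expansion G f H W c
    by unfold_locales blast+
  show ?thesis
    by (rule domination_number_add_alpha2)
qed

end
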